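(* Let $f$ be the global classical solution of the repulsive Vlasov--Poisson system with initial datum $0\le f_0\in C_c^1(\mathbb{R}^3\times\mathbb{R}^3)$. Along every characteristic $(X_*,V_* )$, $$\frac{d}{dt}\mathscr{E}_*(t)+\frac{|w_*(t)|^2+U(t,X_*(t))}{1+t}=\mathcal{J}_*(t).$$ In particular, $$\frac{d}{dt}\mathscr{E}_*(t)+\frac{\mathscr{E}_*(t)}{1+t}\le|\mathcal{J}_*(t)|.$$
   Context: The repulsive Vlasov--Poisson system for $f=f(t,x,v)\ge 0$, $t\ge0$, $x,v\in\mathbb{R}^3$, is $$\partial_t f+v\cdot\nabla_x f+E\cdot\nabla_v f=0,\quad f|_{t=0}=f_0,\quad \rho(t,x)=\int_{\mathbb{R}^3}f(t,x,v)\,dv,\quad E(t,x)=\frac1{4\pi}\int_{\mathbb{R}^3}\frac{x-y}{|x-y|^3}\rho(t,y)\,dy,$$ and the Coulomb potential is $U(t,x)=\frac1{4\pi}\int_{\mathbb{R}^3}\frac{\rho(t,y)}{|x-y|}\,dy\ge0$, so $E=-\nabla_xU$. For $0\le f_0\in C_c^1$ there is a global classical solution $f$ (known), with $f(t)$ compactly supported for each $t$. A characteristic is a solution $(X_*,V_* )$ of $\dot X_*(t)=V_*(t)$, $\dot V_*(t)=E(t,X_*(t))$. Put $w(t,x,v):=v-\frac{x}{1+t}$, $w_*(t):=V_*(t)-\frac{X_*(t)}{1+t}$, and $$\mathscr{E}_*(t):=\tfrac12|w_*(t)|^2+U(t,X_*(t)),$$ $$\mathcal{J}_*(t):=\frac1{4\pi}\iint_{\mathbb{R}^3\times\mathbb{R}^3}w(t,x,v)\cdot\frac{X_*(t)-x}{|X_*(t)-x|^3}\,f(t,x,v)\,dx\,dv.$$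 *)

theory Defs
  imports "HOL-Analysis.Analysis"
begin

text \<open>Derivatives are taken within \<open>S\<close>, hence one-sided at the boundary time \<open>t = 0\<close> below.\<close>

definition C1_on :: "('a::real_normed_vector \<Rightarrow> 'b::real_normed_vector) \<Rightarrow> 'a set \<Rightarrow> bool" where
  "C1_on g S \<longleftrightarrow>
     (\<exists>g' :: 'a \<Rightarrow> 'a \<Rightarrow>\<^sub>L 'b.
        (\<forall>z\<in>S. (g has_derivative blinfun_apply (g' z)) (at z within S)) \<and> continuous_on S g')"

definition compactly_supported :: "('a::topological_space \<Rightarrow> real) \<Rightarrow> bool" where
  "compactly_supported g \<longleftrightarrow> compact (closure {z. g z \<noteq> 0})"

definition gradient :: "('a::real_inner \<Rightarrow> real) \<Rightarrow> 'a \<Rightarrow> 'a" where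
  "gradient g x = (THE D. GDERIV g x :> D)"

definition mass_density :: "(real \<Rightarrow> real^3 \<Rightarrow> real^3 \<Rightarrow> real) \<Rightarrow> real \<Rightarrow> real^3 \<Rightarrow> real" where
  "mass_density f t x = (LINT v|lborel. f t x v)"

text \<open>In the three kernels below, division by zero gives the value \<open>0\<close> on the diagonal, which is a
  null set.\<close>

definition coulomb_field :: "(real \<Rightarrow> real^3 \<Rightarrow> real^3 \<Rightarrow> real) \<Rightarrow> real \<Rightarrow> real^3 \<Rightarrow> real^3" where
  "coulomb_field f t x =
     (1 / (4 * pi)) *\<^sub>R (LINT y|lborel. mass_density f t y *\<^sub>R ((x - y) /\<^sub>R norm (x - y) ^ 3))"

definition potential :: "(real \<Rightarrow> real^3 \<Rightarrow> real^3 \<Rightarrow> real) \<Rightarrow> real \<Rightarrow> real^3 \<Rightarrow> real" where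
  "potential f t x = 1 / (4 * pi) * (LINT y|lborel. mass_density f t y / norm (x - y))"

text \<open>Global classical solutions for \<open>C\<^sup>1\<close> data of compact support: the supports of the \<open>f(t)\<close> are
  compact, locally uniformly in \<open>t\<close>. This is the class in which the Cauchy problem is globally
  well posed; it makes all the integrals in this theory converge absolutely.\<close>

definition vlasov_poisson_solution ::
    "((real^3) \<times> (real^3) \<Rightarrow> real) \<Rightarrow> (real \<Rightarrow> real^3 \<Rightarrow> real^3 \<Rightarrow> real) \<Rightarrow> bool" where
  "vlasov_poisson_solution f\<^sub>0 f \<longleftrightarrow>
     C1_on (\<lambda>(t, x, v). f t x v) ({0..} \<times> UNIV) \<and>
     (\<forall>t\<ge>0. \<forall>x v. f t x v \<ge> 0) \<and>
     (\<forall>T\<ge>0. \<exists>R. \<forall>t\<in>{0..T}. \<forall>x v. f t x v \<noteq> 0 \<longrightarrow> norm x \<le> R \<and> norm v \<le> R) \<and>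
     (\<forall>x v. f 0 x v = f\<^sub>0 (x, v)) \<and>
     (\<forall>t\<ge>0. \<forall>x v.
        vector_derivative (\<lambda>s. f s x v) (at t within {0..})
        + v \<bullet> gradient (\<lambda>y. f t y v) x
        + coulomb_field f t x \<bullet> gradient (\<lambda>u. f t x u) v = 0)"

text \<open>Characteristics on an arbitrary nondegenerate time interval, in particular on \<open>[0, \<infinity>)\<close>.\<close>

definition characteristic ::
    "(real \<Rightarrow> real^3 \<Rightarrow> real^3 \<Rightarrow> real) \<Rightarrow> real set \<Rightarrow> (real \<Rightarrow> real^3) \<Rightarrow> (real \<Rightarrow> real^3) \<Rightarrow> bool" where
  "characteristic f I X V \<longleftrightarrow>
     is_interval I \<and> interior I \<noteq> {} \<and> I \<subseteq> {0..} \<and>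
     (\<forall>t\<in>I. (X has_vector_derivative V t) (at t within I) \<and>
             (V has_vector_derivative coulomb_field f t (X t)) (at t within I))"

definition rel_velocity :: "real \<Rightarrow> real^3 \<Rightarrow> real^3 \<Rightarrow> real^3" where
  "rel_velocity t x v = v - x /\<^sub>R (1 + t)"

definition char_energy ::
    "(real \<Rightarrow> real^3 \<Rightarrow> real^3 \<Rightarrow> real) \<Rightarrow> (real \<Rightarrow> real^3) \<Rightarrow> (real \<Rightarrow> real^3) \<Rightarrow> real \<Rightarrow> real" where
  "char_energy f X V t = 1 / 2 * (norm (rel_velocity t (X t) (V t)))\<^sup>2 + potential f t (X t)"

definition char_source ::
    "(real \<Rightarrow> real^3 \<Rightarrow> real^3 \<Rightarrow> real) \<Rightarrow> (real \<Rightarrow> real^3) \<Rightarrow> real \<Rightarrow> real" where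
  "char_source f X t =
     1 / (4 * pi) *
     (LINT (x, v)|lborel.
        (rel_velocity t x v \<bullet> ((X t - x) /\<^sub>R norm (X t - x) ^ 3)) * f t x v)"

end

theory Submission
  imports Defs
begin

text \<open>Centring the integrals at the characteristic,
  \<open>4 \<pi> U(s, X s) = \<integral>\<integral> f(s, X s + z, v) / |z| dz dv\<close>, moves all time dependence into the \<open>C\<^sup>1\<close> factor, so
  one may differentiate under the integral sign although the kernel is singular. By the Vlasov equation
  the derivative of \<open>f\<close> in the direction \<open>(1, V, 0)\<close> equals that in the direction \<open>(0, V - v, - E)\<close>.
  Its \<open>v\<close>-part integrates to zero for each fixed \<open>z\<close>, and integration by parts in \<open>z\<close> moves the
  \<open>x\<close>-part onto the kernel. This gives
  \<open>dU/ds = - V \<bullet> E - 1/(4 \<pi>) \<integral>\<integral> f v \<bullet> z / |z|\<^sup>3 dz dv\<close>. Expanding \<open>v - (X + z) / (1 + t)\<close> in the source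
  term and using \<open>z \<bullet> z / |z|\<^sup>3 = 1 / |z|\<close> expresses it through the same integral, \<open>U\<close> and \<open>X \<bullet> E\<close>.\<close>

section \<open>Locally integrable functions\<close>

text \<open>Balls about the origin exhaust the space, so this covers every compact set. It is the
  condition under which a kernel can be integrated against a continuous function of compact
  support.\<close>

definition locally_integrable :: "('a::euclidean_space \<Rightarrow> 'b::{banach, second_countable_topology}) \<Rightarrow> bool" where
  "locally_integrable k \<longleftrightarrow> k \<in> borel_measurable borel \<and> (\<forall>r. set_integrable lborel (cball 0 r) k)"

text \<open>The ball is cut into the dyadic shells \<open>r / 2 ^ (k + 1) < norm z \<le> r / 2 ^ k\<close>; the integrals over
  the shells are dominated by a geometric series of ratio \<open>2 ^ p / 2 ^ DIM('a)\<close>.\<close>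

lemma nn_integral_norm_power_cball:
  fixes p :: nat and r :: real
  assumes p: "p < DIM('a::euclidean_space)" and r: "r > 0"
  shows "(\<integral>\<^sup>+z. ennreal (indicator (cball 0 r) z * (1 / norm (z::'a) ^ p)) \<partial>lborel) < \<infinity>"
proof -
  let ?n = "DIM('a)"
  let ?a = "\<lambda>k::nat. (2 ^ (k + 1) / r) ^ p"
  let ?b = "\<lambda>k. cball (0::'a) (r / 2 ^ k)"
  let ?C = "(2 / r) ^ p * unit_ball_vol ?n * r ^ ?n"
  let ?q = "2 ^ p / 2 ^ ?n :: real"
  have q: "?q < 1" using p by simp
  have [measurable]: "?b k \<in> sets borel" for k by simp
  have le: "ennreal (indicator (cball 0 r) z * (1 / norm z ^ p))
      \<le> (\<Sum>k. ennreal (?a k) * indicator (?b k) z)" if z: "z \<noteq> 0" for z :: 'a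
  proof (cases "norm z \<le> r")
    case True
    have "\<exists>k. r / 2 ^ (k + 1) < norm z"
    proof -
      obtain k where "(1/2::real) ^ k < norm z / r"
        using real_arch_pow_inv[of "norm z / r" "1/2"] z r by auto
      then have "r / 2 ^ k < norm z" using r by (simp add: field_simps)
      moreover have "r / 2 ^ (k + 1) \<le> r / 2 ^ k" using r by (simp add: field_simps)
      ultimately show ?thesis by (intro exI[of _ k]) linarith
    qed
    \<comment> \<open>The least such \<open>k\<close> places \<open>z\<close> in the
      \<open>k\<close>-th shell. The shell is then enlarged to the whole ball \<open>?b k\<close>,
      whose volume still decays by the factor \<open>1 / 2 ^ ?n\<close> at each step.\<close>
    then obtain k where k: "r / 2 ^ (k + 1) < norm z"
      and least: "\<And>j. j < k \<Longrightarrow> \<not> r / 2 ^ (j + 1) < norm z"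
      using exists_least_iff[of "\<lambda>k. r / 2 ^ (k + 1) < norm z"] by blast
    have "norm z \<le> r / 2 ^ k"
      using least[of "k - 1"] True by (cases k) auto
    then have zk: "z \<in> ?b k" by simp
    have "1 / norm z \<le> 2 ^ (k + 1) / r"
      using k r z by (simp add: field_simps)
    then have "(1 / norm z) ^ p \<le> ?a k" by (intro power_mono) auto
    then have "ennreal (indicator (cball 0 r) z * (1 / norm z ^ p)) \<le> ennreal (?a k) * indicator (?b k) z"
      using True zk by (simp add: power_one_over ennreal_leI)
    also have "\<dots> \<le> (\<Sum>k. ennreal (?a k) * indicator (?b k) z)"
    proof -
      have "g k \<le> suminf g" for g :: "nat \<Rightarrow> ennreal"
        using sum_le_suminf[OF summableI, of "{k}" g] by simp
      then show ?thesis .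
    qed
    finally show ?thesis .
  qed simp
  have "(\<integral>\<^sup>+z. ennreal (indicator (cball 0 r) z * (1 / norm (z::'a) ^ p)) \<partial>lborel)
      \<le> (\<integral>\<^sup>+z. (\<Sum>k. ennreal (?a k) * indicator (?b k) z) \<partial>lborel)"
    using le by (intro nn_integral_mono_AE, use AE_lborel_singleton[of "0::'a"] in eventually_elim) auto
  also have "\<dots> = (\<Sum>k. \<integral>\<^sup>+z. ennreal (?a k) * indicator (?b k) z \<partial>lborel)"
    by (intro nn_integral_suminf) measurable
  also have "\<dots> = (\<Sum>k. ennreal (?C * ?q ^ k))"
  proof (intro suminf_cong)
    fix k
    have "(\<integral>\<^sup>+z. ennreal (?a k) * indicator (?b k) z \<partial>lborel)
        = ennreal (?a k) * emeasure lborel (?b k)"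
      by (intro nn_integral_cmult_indicator) simp
    also have "\<dots> = ennreal (?a k * (unit_ball_vol ?n * (r / 2 ^ k) ^ ?n))"
      using r by (subst emeasure_cball) (auto simp: ennreal_mult)
    also have "?a k * (unit_ball_vol ?n * (r / 2 ^ k) ^ ?n) = ?C * ?q ^ k"
      using r by (simp add: power_divide power_mult_distrib field_simps flip: power_mult)
    finally show "(\<integral>\<^sup>+z. ennreal (?a k) * indicator (?b k) z \<partial>lborel) = ennreal (?C * ?q ^ k)" .
  qed
  also have "\<dots> < \<infinity>"
  proof -
    have "summable (\<lambda>k. ?C * ?q ^ k)"
      using q by (intro summable_mult summable_geometric) simp
    then show ?thesis
      using r by (subst suminf_ennreal2) auto
  qed
  finally show ?thesis .
qed

lemma locally_integrable_norm_power:
  assumes "p < DIM('a::euclidean_space)"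
  shows "locally_integrable (\<lambda>z::'a. 1 / norm z ^ p)"
  unfolding locally_integrable_def
proof (intro conjI allI)
  fix r :: real
  \<comment> \<open>The shell estimate requires a positive radius, so \<open>r\<close> is first
    enlarged and the result restricted to the smaller ball.\<close>
  let ?r = "max r 1"
  have "integrable lborel (\<lambda>z::'a. indicator (cball 0 ?r) z * (1 / norm z ^ p))"
    by (intro integrableI_nonneg nn_integral_norm_power_cball assms, measurable) auto
  then have "set_integrable lborel (cball 0 ?r) (\<lambda>z::'a. 1 / norm z ^ p)"
    by (simp add: set_integrable_def)
  then show "set_integrable lborel (cball 0 r) (\<lambda>z::'a. 1 / norm z ^ p)"
    by (rule set_integrable_subset) auto
qed simp

lemma locally_integrable_bound:
  assumes "locally_integrable k" and "l \<in> borel_measurable borel" and "\<And>z. norm (l z) \<le> norm (k z)"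
  shows "locally_integrable l"
  unfolding locally_integrable_def set_integrable_def
proof (intro conjI allI assms(2))
  fix r
  show "integrable lborel (\<lambda>x. indicator (cball 0 r) x *\<^sub>R l x)"
  proof (rule Bochner_Integration.integrable_bound)
    show "integrable lborel (\<lambda>x. indicator (cball 0 r) x *\<^sub>R k x)"
      using assms(1) by (simp add: locally_integrable_def set_integrable_def)
    show "(\<lambda>x. indicator (cball 0 r) x *\<^sub>R l x) \<in> borel_measurable lborel"
      using assms(2) by (intro borel_measurable_scaleR borel_measurable_indicator) auto
  qed (use assms(3) in \<open>auto intro!: mult_left_mono\<close>)
qed

text \<open>A ball of the product lies in a product of balls, and there the integrand is constant
  along the second factor, which contributes only the finite measure of a ball. In this way a kernel
  in position becomes a kernel on phase space.\<close>

lemma locally_integrable_fst: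
  fixes k :: "'a::euclidean_space \<Rightarrow> 'c::{banach, second_countable_topology}"
  assumes "locally_integrable k"
  shows "locally_integrable (\<lambda>p::'a \<times> 'b::euclidean_space. k (fst p))"
  unfolding locally_integrable_def
proof (intro conjI allI)
  have [measurable]: "k \<in> borel_measurable borel"
    using assms by (simp add: locally_integrable_def)
  show "(\<lambda>p::'a \<times> 'b. k (fst p)) \<in> borel_measurable borel"
    unfolding borel_prod[symmetric] by measurable
  fix r :: real
  let ?A = "cball (0::'a) r" and ?B = "cball (0::'b) r"
  have k: "integrable lborel (\<lambda>x. indicator ?A x *\<^sub>R k x)"
    using assms by (simp add: locally_integrable_def set_integrable_def)
  have "integrable (lborel \<Otimes>\<^sub>M lborel) (\<lambda>p. indicator (?A \<times> ?B) p *\<^sub>R k (fst p))"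
  proof (rule lborel_pair.Fubini_integrable)
    have "integrable lborel (\<lambda>x. norm (indicator ?A x *\<^sub>R k x) * measure lborel ?B)"
      using k by (intro integrable_mult_left integrable_norm)
    moreover have "(LINT y|lborel. norm (indicator (?A \<times> ?B) (x, y) *\<^sub>R k (fst (x, y))))
        = norm (indicator ?A x *\<^sub>R k x) * measure lborel ?B" for x
      by (simp add: indicator_times mult_ac)
    ultimately show "integrable lborel (\<lambda>x. LINT y|lborel. norm (indicator (?A \<times> ?B) (x, y) *\<^sub>R k (fst (x, y))))"
      by (simp only:)
    have "integrable lborel (\<lambda>y. indicator ?B y *\<^sub>R (indicator ?A x *\<^sub>R k x))" for x
      using emeasure_bounded_finite[of "cball (0::'b) r"]
      by (intro integrable_scaleR_left integrable_real_indicator) auto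
    then show "AE x in lborel. integrable lborel (\<lambda>y. indicator (?A \<times> ?B) (x, y) *\<^sub>R k (fst (x, y)))"
      by (intro AE_I2) (simp add: indicator_times mult_ac)
  qed measurable
  then have "set_integrable lborel (?A \<times> ?B) (\<lambda>p. k (fst p))"
    by (simp add: set_integrable_def lborel_prod)
  then show "set_integrable lborel (cball (0::'a \<times> 'b) r) (\<lambda>p. k (fst p))"
  proof (rule set_integrable_subset)
    show "cball (0::'a \<times> 'b) r \<subseteq> ?A \<times> ?B"
    proof
      fix p :: "'a \<times> 'b" assume "p \<in> cball 0 r"
      then show "p \<in> ?A \<times> ?B"
        using norm_fst_le[of "fst p" "snd p"] norm_snd_le[of "snd p" "fst p"] by (auto simp: mem_Times_iff)
    qed
  qed simp
qed

text \<open>A continuous \<open>h\<close> is bounded by some \<open>C\<close> on the ball outside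
  which it vanishes, so \<open>C\<close> times the truncated kernel dominates.\<close>

lemma integrable_scaleR_locally_integrable:
  fixes h :: "'a::euclidean_space \<Rightarrow> real"
  assumes "continuous_on UNIV h" and supp: "\<And>z. norm z > R \<Longrightarrow> h z = 0" and "locally_integrable k"
  shows "integrable lborel (\<lambda>z. h z *\<^sub>R k z)"
proof -
  have [measurable]: "k \<in> borel_measurable borel" and k: "set_integrable lborel (cball 0 R) k"
    using assms(3) by (auto simp: locally_integrable_def)
  have [measurable]: "h \<in> borel_measurable borel"
    using assms(1) by (rule borel_measurable_continuous_onI)
  have "bounded (h ` cball 0 R)"
    using assms(1) by (intro compact_imp_bounded compact_continuous_image continuous_on_subset[OF assms(1)]) auto
  then obtain C where "\<forall>y\<in>h ` cball 0 R. \<bar>y\<bar> \<le> C"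
    unfolding bounded_iff real_norm_def by blast
  then have C: "\<bar>h z\<bar> \<le> C" if "norm z \<le> R" for z
    using that by simp
  show ?thesis
  proof (rule Bochner_Integration.integrable_bound)
    show "integrable lborel (\<lambda>z. C *\<^sub>R (indicator (cball 0 R) z *\<^sub>R k z))"
      using k unfolding set_integrable_def by (rule integrable_scaleR_right)
    have "norm (h z *\<^sub>R k z) \<le> norm (C *\<^sub>R (indicator (cball 0 R) z *\<^sub>R k z))" for z
      using C[of z] supp[of z] by (cases "norm z \<le> R") (auto intro!: mult_right_mono)
    then show "AE z in lborel. norm (h z *\<^sub>R k z) \<le> norm (C *\<^sub>R (indicator (cball 0 R) z *\<^sub>R k z))"
      by simp
  qed measurable
qed

text \<open>Dominated convergence applied to the difference quotients along an arbitrary sequence in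
  \<open>S\<close>. The Lipschitz bound compares only with the base time \<open>t\<close>, and
  working within \<open>S\<close> covers one-sided derivatives.\<close>

lemma has_real_derivative_integral:
  fixes G :: "real \<Rightarrow> 'a \<Rightarrow> real"
  assumes int: "\<And>s. s \<in> S \<Longrightarrow> integrable M (G s)" and t: "t \<in> S"
    and der: "\<And>z. ((\<lambda>s. G s z) has_real_derivative G' z) (at t within S)"
    and meas: "G' \<in> borel_measurable M"
    and bound: "\<And>s z. s \<in> S \<Longrightarrow> \<bar>G s z - G t z\<bar> \<le> B z * \<bar>s - t\<bar>"
    and B: "integrable M B"
  shows "((\<lambda>s. integral\<^sup>L M (G s)) has_real_derivative integral\<^sup>L M G') (at t within S)"
  unfolding has_field_derivative_iff tendsto_at_iff_sequentially comp_def
proof (intro allI impI)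
  fix s :: "nat \<Rightarrow> real" assume s: "\<forall>i. s i \<in> S - {t}" and lim: "s \<longlonglongrightarrow> t"
  have "(\<lambda>i. LINT z|M. (G (s i) z - G t z) / (s i - t)) \<longlonglongrightarrow> integral\<^sup>L M G'"
  proof (rule integral_dominated_convergence[OF meas _ B])
    show "(\<lambda>z. (G (s i) z - G t z) / (s i - t)) \<in> borel_measurable M" for i
      using s t int[THEN borel_measurable_integrable] by (intro borel_measurable_divide borel_measurable_diff) auto
    show "AE z in M. (\<lambda>i. (G (s i) z - G t z) / (s i - t)) \<longlonglongrightarrow> G' z"
      using der s lim unfolding has_field_derivative_iff tendsto_at_iff_sequentially comp_def by auto
    show "AE z in M. norm ((G (s i) z - G t z) / (s i - t)) \<le> B z" for i
      using bound[of "s i"] s by (auto simp: divide_le_eq)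
  qed
  moreover have "(LINT z|M. (G (s i) z - G t z) / (s i - t))
      = (integral\<^sup>L M (G (s i)) - integral\<^sup>L M (G t)) / (s i - t)" for i
    using s t int by simp
  ultimately show "(\<lambda>i. (integral\<^sup>L M (G (s i)) - integral\<^sup>L M (G t)) / (s i - t)) \<longlonglongrightarrow> integral\<^sup>L M G'"
    by (simp only:)
qed

section \<open>Differentiation under the integral and integration by parts\<close>

lemma lborel_integral_translate:
  fixes f :: "'a::euclidean_space \<Rightarrow> 'b::{banach, second_countable_topology}"
  assumes "f \<in> borel_measurable borel"
  shows "(LINT z|lborel. f (c + z)) = integral\<^sup>L lborel f"
proof -
  have "integral\<^sup>L lborel f = integral\<^sup>L (distr lborel borel ((+) c)) f"
    by (simp add: lborel_distr_plus)
  also have "\<dots> = (LINT z|lborel. f (c + z))"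
    using assms by (intro integral_distr) auto
  finally show ?thesis ..
qed

text \<open>The set is compact, so the continuous derivative is bounded on it, and convex, so the
  mean value inequality turns this bound into a Lipschitz constant.\<close>

lemma C1_lipschitz_cball:
  fixes g :: "real \<times> 'a::euclidean_space \<Rightarrow> real"
  assumes der: "\<And>q. q \<in> {0..} \<times> UNIV \<Longrightarrow> (g has_derivative blinfun_apply (g' q)) (at q within {0..} \<times> UNIV)"
    and cont: "continuous_on ({0..} \<times> UNIV) g'"
  obtains L where "L \<ge> 0"
    and "\<And>q q'. q \<in> {0..T} \<times> cball 0 r \<Longrightarrow> q' \<in> {0..T} \<times> cball 0 r \<Longrightarrow> \<bar>g q - g q'\<bar> \<le> L * norm (q - q')"
proof -
  let ?K = "{0..T} \<times> cball (0::'a) r"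
  have sub: "?K \<subseteq> {0..} \<times> UNIV" by auto
  have "bounded (g' ` ?K)"
    by (intro compact_imp_bounded compact_continuous_image continuous_on_subset[OF cont] compact_Times) auto
  then obtain L where L: "L > 0" "\<forall>y\<in>g' ` ?K. norm y \<le> L"
    unfolding bounded_pos by blast
  show thesis
  proof (rule that[of L])
    fix q q' assume "q \<in> ?K" "q' \<in> ?K"
    then have "norm (g q - g q') \<le> L * norm (q - q')"
    proof (rule differentiable_bound[rotated -2])
      show "convex ?K" by (intro convex_Times) auto
      fix p assume p: "p \<in> ?K"
      show "(g has_derivative blinfun_apply (g' p)) (at p within ?K)"
        using der[of p] sub p by (intro has_derivative_subset[OF _ sub]) auto
      show "onorm (blinfun_apply (g' p)) \<le> L"
        using bspec[OF L(2) imageI[OF p]] by (simp only: norm_blinfun.rep_eq)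
    qed
    then show "\<bar>g q - g q'\<bar> \<le> L * norm (q - q')" by simp
  qed (use L in simp)
qed

text \<open>Only \<open>g\<close> depends on \<open>s\<close>, so no derivative falls on the
  possibly singular \<open>k\<close>: a Lipschitz constant of \<open>g\<close> on a compact set
  times the truncated \<open>\<bar>k\<bar>\<close> dominates the difference quotients. Their limit
  is the chain rule along \<open>s \<mapsto> (s, c s + p)\<close>, whose velocity is
  \<open>(1, c')\<close>.\<close>

lemma has_real_derivative_integral_translate:
  fixes g :: "real \<times> 'a::euclidean_space \<Rightarrow> real" and c :: "real \<Rightarrow> 'a" and k :: "'a \<Rightarrow> real"
  assumes der: "\<And>q. q \<in> {0..} \<times> UNIV \<Longrightarrow> (g has_derivative blinfun_apply (g' q)) (at q within {0..} \<times> UNIV)"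
    and cont: "continuous_on ({0..} \<times> UNIV) g'"
    and supp: "\<And>s p. s \<in> {0..T} \<Longrightarrow> norm p > R \<Longrightarrow> g (s, p) = 0"
    and I: "I \<subseteq> {0..}" and t: "t \<in> I" "t < T"
    and c: "(c has_vector_derivative c') (at t within I)"
    and k: "locally_integrable k"
  shows "((\<lambda>s. LINT p|lborel. g (s, c s + p) * k p) has_real_derivative
      (LINT p|lborel. blinfun_apply (g' (t, c t + p)) (1, c') * k p)) (at t within I)"
proof -
  \<comment> \<open>\<open>M\<close> comes from the first-order expansion of \<open>c\<close> at
    \<open>t\<close> with error at most \<open>\<bar>s - t\<bar>\<close>; \<open>C\<close> then
    bounds \<open>norm (c s)\<close> as long as \<open>\<bar>s - t\<bar> < 1\<close>.\<close>
  define M where "M = norm c' + 1"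
  define C where "C = norm (c t) + M"
  have M: "M > 0" unfolding M_def using norm_ge_zero[of c'] by linarith
  have t0: "t \<ge> 0" using I t by auto
  from c obtain d where d: "d > 0"
    and dc: "\<And>s. s \<in> I \<Longrightarrow> norm (s - t) < d \<Longrightarrow> norm (c s - c t - (s - t) *\<^sub>R c') \<le> 1 * norm (s - t)"
    unfolding has_vector_derivative_def has_derivative_within_alt by (metis zero_less_one)
  \<comment> \<open>The three bounds secure, in turn, the expansion of \<open>c\<close>, the bound
    \<open>C\<close>, and that \<open>s\<close> stays in the time interval on which the support is
    controlled.\<close>
  define e where "e = min d (min 1 (T - t))"
  have e: "e > 0" using d t by (simp add: e_def)
  define S where "S = I \<inter> ball t e"
  have tS: "t \<in> S" using t e by (simp add: S_def)
  have S: "s \<in> {0..T}" "norm (c s - c t) \<le> M * \<bar>s - t\<bar>" "norm (c s) \<le> C" if "s \<in> S" for s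
  proof -
    have s: "s \<in> I" "\<bar>s - t\<bar> < d" "\<bar>s - t\<bar> < 1" "\<bar>s - t\<bar> < T - t"
      using that by (auto simp: S_def e_def dist_real_def)
    then show "s \<in> {0..T}" using I by auto
    have "norm (c s - c t) \<le> norm (c s - c t - (s - t) *\<^sub>R c') + norm ((s - t) *\<^sub>R c')"
      by (metis diff_add_cancel norm_triangle_ineq)
    also have "\<dots> \<le> \<bar>s - t\<bar> + \<bar>s - t\<bar> * norm c'"
      using dc[of s] s by simp
    finally show "norm (c s - c t) \<le> M * \<bar>s - t\<bar>"
      by (simp add: M_def algebra_simps)
    also have "\<dots> \<le> M * 1" using M s by (intro mult_left_mono) auto
    finally show "norm (c s) \<le> C"
      using norm_triangle_ineq2[of "c s" "c t"] by (simp add: C_def)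
  qed
  \<comment> \<open>If \<open>norm z \<le> R + C\<close>, the points \<open>c s + z\<close> have
    norm at most \<open>R + 2 * C\<close>; for larger \<open>z\<close> they have norm above
    \<open>R\<close>, where \<open>g\<close> vanishes.\<close>
  obtain L where L: "L \<ge> 0"
    and lip: "\<And>q q'. q \<in> {0..T} \<times> cball 0 (R + 2 * C) \<Longrightarrow> q' \<in> {0..T} \<times> cball 0 (R + 2 * C) \<Longrightarrow> \<bar>g q - g q'\<bar> \<le> L * norm (q - q')"
    using C1_lipschitz_cball[OF der cont] by blast
  have g_cont: "continuous_on ({0..} \<times> UNIV) g"
    using der by (rule has_derivative_continuous_on)
  have [measurable]: "k \<in> borel_measurable borel" using k by (simp add: locally_integrable_def)
  have "((\<lambda>s. LINT p|lborel. g (s, c s + p) * k p) has_real_derivative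
      (LINT p|lborel. blinfun_apply (g' (t, c t + p)) (1, c') * k p)) (at t within S)"
  proof (rule has_real_derivative_integral[OF _ tS])
    fix s assume s: "s \<in> S"
    have "integrable lborel (\<lambda>z. g (s, c s + z) *\<^sub>R k z)"
    proof (rule integrable_scaleR_locally_integrable[OF _ _ k])
      show "continuous_on UNIV (\<lambda>z. g (s, c s + z))"
        using S(1)[OF s] by (intro continuous_on_compose2[OF g_cont] continuous_intros) auto
      fix z :: 'a assume "R + norm (c s) < norm z"
      then show "g (s, c s + z) = 0"
        using norm_triangle_ineq4[of "c s + z" "c s"] S(1)[OF s] by (intro supp) auto
    qed
    then show "integrable lborel (\<lambda>z. g (s, c s + z) * k z)" by simp
  next
    fix z
    have "((\<lambda>s. (s, c s + z)) has_derivative (\<lambda>h. (h, h *\<^sub>R c'))) (at t within S)"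
    proof -
      have "(c has_derivative (\<lambda>h. h *\<^sub>R c')) (at t within S)"
        using c unfolding has_vector_derivative_def S_def by (rule has_derivative_subset) auto
      from has_derivative_Pair[OF has_derivative_ident has_derivative_add[OF this has_derivative_const[of z]]]
      show ?thesis by simp
    qed
    moreover have "(g has_derivative blinfun_apply (g' (t, c t + z))) (at (t, c t + z) within (\<lambda>s. (s, c s + z)) ` S)"
      using I t0 by (intro has_derivative_subset[OF der]) (auto simp: S_def)
    ultimately have "((\<lambda>s. g (s, c s + z)) has_derivative (\<lambda>h. blinfun_apply (g' (t, c t + z)) (h, h *\<^sub>R c'))) (at t within S)"
      by (rule has_derivative_in_compose)
    moreover have "blinfun_apply (g' (t, c t + z)) (h, h *\<^sub>R c') = blinfun_apply (g' (t, c t + z)) (1, c') * h" for h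
      using blinfun.scaleR_right[of "g' (t, c t + z)" h "(1, c')"] by simp
    ultimately have "((\<lambda>s. g (s, c s + z)) has_real_derivative blinfun_apply (g' (t, c t + z)) (1, c')) (at t within S)"
      by (simp add: has_field_derivative_def)
    then show "((\<lambda>s. g (s, c s + z) * k z) has_real_derivative blinfun_apply (g' (t, c t + z)) (1, c') * k z) (at t within S)"
      by (rule DERIV_cmult_right)
  next
    have "continuous_on UNIV (\<lambda>p. blinfun_apply (g' (t, c t + p)) (1, c'))"
      using t0 by (intro continuous_intros continuous_on_compose2[OF cont]) auto
    then have [measurable]: "(\<lambda>p. blinfun_apply (g' (t, c t + p)) (1, c')) \<in> borel_measurable borel"
      by (rule borel_measurable_continuous_onI)
    show "(\<lambda>p. blinfun_apply (g' (t, c t + p)) (1, c') * k p) \<in> borel_measurable lborel"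
      by measurable
  next
    fix s z assume s: "s \<in> S"
    show "\<bar>g (s, c s + z) * k z - g (t, c t + z) * k z\<bar>
        \<le> L * (1 + M) * \<bar>indicator (cball 0 (R + C)) z *\<^sub>R k z\<bar> * \<bar>s - t\<bar>"
    proof (cases "norm z \<le> R + C")
      case True
      have "norm (c s + z) \<le> R + 2 * C" "norm (c t + z) \<le> R + 2 * C"
        using norm_triangle_ineq[of "c s" z] norm_triangle_ineq[of "c t" z] S(3)[OF s] S(3)[OF tS] True by linarith+
      then have "\<bar>g (s, c s + z) - g (t, c t + z)\<bar> \<le> L * norm ((s, c s + z) - (t, c t + z))"
        using S(1)[OF s] S(1)[OF tS] by (intro lip) auto
      also have "norm ((s, c s + z) - (t, c t + z)) \<le> \<bar>s - t\<bar> + norm (c s - c t)"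
        using norm_Pair_le[of "s - t" "c s - c t"] by simp
      also have "\<dots> \<le> (1 + M) * \<bar>s - t\<bar>"
        using S(2)[OF s] by (simp add: algebra_simps)
      finally have "\<bar>g (s, c s + z) - g (t, c t + z)\<bar> * \<bar>k z\<bar> \<le> L * ((1 + M) * \<bar>s - t\<bar>) * \<bar>k z\<bar>"
        using L by (intro mult_right_mono) (auto intro: mult_left_mono)
      then show ?thesis
        using True by (simp add: abs_mult mult_ac flip: right_diff_distrib)
    next
      case False
      have "norm (c s + z) > R" "norm (c t + z) > R"
        using norm_triangle_ineq4[of "c s + z" "c s"] norm_triangle_ineq4[of "c t + z" "c t"] S(3)[OF s] S(3)[OF tS] False
        unfolding add_diff_cancel_left' by linarith+
      then show ?thesis using S(1)[OF s] S(1)[OF tS] supp L M by simp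
    qed
  next
    show "integrable lborel (\<lambda>z. L * (1 + M) * \<bar>indicator (cball 0 (R + C)) z *\<^sub>R k z\<bar>)"
      using k by (intro integrable_mult_right integrable_abs) (simp add: locally_integrable_def set_integrable_def)
  qed
  moreover have "at t within S = at t within I"
    by (rule at_within_nhd[of _ "ball t e"]) (use e in \<open>auto simp: S_def\<close>)
  ultimately show ?thesis by simp
qed

lemma locally_integrable_const: "locally_integrable (\<lambda>_::'a::euclidean_space. c::'b::{banach, second_countable_topology})"
  unfolding locally_integrable_def set_integrable_def
  using emeasure_bounded_finite[of "cball (0::'a) _"]
  by (auto intro!: integrable_scaleR_left integrable_real_indicator)

text \<open>By translation invariance the integral of \<open>\<phi>\<close> shifted along
  \<open>a\<close> is constant in the shift, so its derivative, the integral in question, is zero.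
  Differentiation under the integral is the moving-centre lemma with kernel 1.\<close>

lemma integral_directional_derivative_eq_0:
  fixes \<phi> :: "'a::euclidean_space \<Rightarrow> real"
  assumes der: "\<And>z. (\<phi> has_derivative blinfun_apply (\<phi>' z)) (at z)"
    and cont: "continuous_on UNIV \<phi>'"
    and supp: "\<And>z. norm z > R \<Longrightarrow> \<phi> z = 0"
  shows "(LINT z|lborel. blinfun_apply (\<phi>' z) a) = 0"
proof -
  \<comment> \<open>The shift vanishes at time 1, an interior point of the half line, so the
    derivative there is two-sided and hence unique.\<close>
  let ?c = "\<lambda>s::real. (s - 1) *\<^sub>R a"
  have "((\<lambda>s. LINT p|lborel. \<phi> (snd (s, ?c s + p)) * 1) has_real_derivative
      (LINT p|lborel. blinfun_apply (\<phi>' (snd (1::real, ?c 1 + p)) o\<^sub>L snd_blinfun) (1::real, a) * 1)) (at 1 within {0<..})"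
  proof (rule has_real_derivative_integral_translate[where g = "\<lambda>q. \<phi> (snd q)"
        and g' = "\<lambda>q. \<phi>' (snd q) o\<^sub>L snd_blinfun" and c = ?c and k = "\<lambda>_. 1" and T = 2 and R = R])
    fix q :: "real \<times> 'a"
    have "(\<phi> \<circ> snd has_derivative blinfun_apply (\<phi>' (snd q)) \<circ> snd) (at q within {0..} \<times> UNIV)"
      by (intro diff_chain_within has_derivative_at_withinI[OF der]) (auto intro!: derivative_eq_intros)
    then show "((\<lambda>q. \<phi> (snd q)) has_derivative blinfun_apply (\<phi>' (snd q) o\<^sub>L snd_blinfun)) (at q within {0..} \<times> UNIV)"
      by (simp add: comp_def blinfun_compose.rep_eq snd_blinfun.rep_eq)
    show "continuous_on ({0..} \<times> UNIV) (\<lambda>q::real \<times> 'a. \<phi>' (snd q) o\<^sub>L snd_blinfun)"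
      by (intro continuous_intros continuous_on_compose2[OF cont]) auto
    show "(?c has_vector_derivative a) (at 1 within {0<..})"
      by (auto intro!: derivative_eq_intros simp: has_vector_derivative_def)
  qed (use supp locally_integrable_const in auto)
  moreover have "\<phi> \<in> borel_measurable borel"
    using der by (intro borel_measurable_continuous_onI has_derivative_continuous_on[of UNIV _ "\<lambda>z. blinfun_apply (\<phi>' z)"]) auto
  then have "(LINT p|lborel. \<phi> (snd (s, ?c s + p)) * 1) = integral\<^sup>L lborel \<phi>" for s :: real
    by (simp add: lborel_integral_translate)
  ultimately have "((\<lambda>s. integral\<^sup>L lborel \<phi>) has_real_derivative (LINT z|lborel. blinfun_apply (\<phi>' z) a)) (at 1)"
    by (simp add: at_within_open[of _ "{0<..}"])
  then show ?thesis
    using DERIV_unique DERIV_const by blast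
qed

text \<open>The complement of the closed ball is open, so \<open>\<phi>\<close> vanishes near
  \<open>z\<close>. This carries support bounds over from functions to their derivatives, as the
  integrability lemmas require.\<close>

lemma has_derivative_eq_0_outside_cball:
  fixes \<phi> :: "'a::real_normed_vector \<Rightarrow> real"
  assumes "(\<phi> has_derivative D) (at z)" and "\<And>z. norm z > R \<Longrightarrow> \<phi> z = 0" and "norm z > R"
  shows "D = (\<lambda>_. 0)"
proof -
  have "open {z::'a. norm z > R}"
    by (intro open_Collect_less continuous_intros)
  from has_derivative_const[of "0::real"] this have "(\<phi> has_derivative (\<lambda>_. 0)) (at z)"
    by (rule has_derivative_transform_within_open) (use assms(2,3) in auto)
  then show ?thesis
    using assms(1) has_derivative_unique by blast
qed

text \<open>The kernel is regularised to \<open>1 / sqrt (z \<bullet> z + 1 / (n + 1)\<^sup>2)\<close>, for which there is no singular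
  boundary term, and dominated convergence removes the regularisation.\<close>

lemma integral_by_parts_inverse_norm:
  fixes \<phi> :: "'a::euclidean_space \<Rightarrow> real"
  assumes dim: "DIM('a) \<ge> 3"
    and der: "\<And>z. (\<phi> has_derivative blinfun_apply (\<phi>' z)) (at z)"
    and cont: "continuous_on UNIV \<phi>'"
    and supp: "\<And>z. norm z > R \<Longrightarrow> \<phi> z = 0"
  shows "(LINT z|lborel. blinfun_apply (\<phi>' z) a / norm z) = (LINT z|lborel. \<phi> z * ((a \<bullet> z) / norm z ^ 3))"
proof -
  \<comment> \<open>\<open>Suc n\<close> keeps the added term positive for \<open>n = 0\<close> as
    well, where \<open>1 / real n\<close> would be 0.\<close>
  define \<kappa> where "\<kappa> n z = 1 / sqrt (z \<bullet> z + (1 / real (Suc n))\<^sup>2)" for n and z :: 'a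
  have pos: "z \<bullet> z + (1 / real (Suc n))\<^sup>2 > 0" for n and z :: 'a
    by (intro add_nonneg_pos) auto
  have \<kappa>_pos: "\<kappa> n z > 0" for n z
    unfolding \<kappa>_def using pos[of z n] by simp
  have \<kappa>_der: "(\<kappa> n has_derivative (\<lambda>h. - (\<kappa> n z ^ 3 * (z \<bullet> h)))) (at z)" for n z
  proof -
    have "sqrt (z \<bullet> z + (1 / real (Suc n))\<^sup>2) ^ 2 = z \<bullet> z + (1 / real (Suc n))\<^sup>2"
      using pos[of z n] by simp
    then show ?thesis
      unfolding \<kappa>_def using pos[of z n]
      by (auto intro!: derivative_eq_intros simp: fun_eq_iff inner_commute power3_eq_cube field_simps)
  qed
  have \<kappa>_cont: "continuous_on UNIV (\<kappa> n)" for n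
    using \<kappa>_der by (intro has_derivative_continuous_on) blast
  have \<phi>_cont: "continuous_on UNIV \<phi>"
    using der by (intro has_derivative_continuous_on) blast
  have \<phi>'_supp: "blinfun_apply (\<phi>' z) a = 0" if "norm z > R" for z
    using has_derivative_eq_0_outside_cball[OF der supp that] by simp
  have \<kappa>_le: "\<kappa> n z \<le> 1 / norm z" if "z \<noteq> 0" for n z
    unfolding \<kappa>_def norm_eq_sqrt_inner using that by (intro frac_le) auto
  have \<kappa>_lim: "(\<lambda>n. \<kappa> n z) \<longlonglongrightarrow> 1 / norm z" if "z \<noteq> 0" for z
  proof -
    have "(\<lambda>n. 1 / sqrt (z \<bullet> z + (1 / real (Suc n))\<^sup>2)) \<longlonglongrightarrow> 1 / sqrt (z \<bullet> z + 0\<^sup>2)"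
      using that by (intro tendsto_intros LIMSEQ_Suc lim_1_over_n) auto
    then show ?thesis by (simp add: \<kappa>_def norm_eq_sqrt_inner)
  qed
  have int1: "integrable lborel (\<lambda>z. blinfun_apply (\<phi>' z) a *\<^sub>R l z)"
    if "locally_integrable l" for l :: "'a \<Rightarrow> real"
    using \<phi>'_supp by (intro integrable_scaleR_locally_integrable[OF _ _ that, where R = R] continuous_intros cont) auto
  have int2: "integrable lborel (\<lambda>z. \<phi> z *\<^sub>R l z)" if "locally_integrable l" for l :: "'a \<Rightarrow> real"
    using supp by (intro integrable_scaleR_locally_integrable[OF _ _ that, where R = R] \<phi>_cont) auto
  have const: "locally_integrable (\<lambda>_::'a. 1::real)" by (rule locally_integrable_const)
  have int3: "integrable lborel (\<lambda>z. (blinfun_apply (\<phi>' z) a * \<kappa> n z) *\<^sub>R (1::real))" for n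
    using \<phi>'_supp by (intro integrable_scaleR_locally_integrable[OF _ _ const, where R = R] continuous_intros cont \<kappa>_cont) auto
  have int4: "integrable lborel (\<lambda>z. (\<phi> z * (\<kappa> n z ^ 3 * (a \<bullet> z))) *\<^sub>R (1::real))" for n
    using supp by (intro integrable_scaleR_locally_integrable[OF _ _ const, where R = R] continuous_intros \<phi>_cont \<kappa>_cont) auto
  have eq: "(LINT z|lborel. blinfun_apply (\<phi>' z) a * \<kappa> n z) = (LINT z|lborel. \<phi> z * (\<kappa> n z ^ 3 * (a \<bullet> z)))" for n
  proof -
    \<comment> \<open>This is the derivative of \<open>\<phi> z * \<kappa> n z\<close> by the
      product rule; the vanishing of its integral in direction \<open>a\<close> is the regularised
      identity.\<close>
    let ?\<psi>' = "\<lambda>z. \<kappa> n z *\<^sub>R \<phi>' z - (\<phi> z * \<kappa> n z ^ 3) *\<^sub>R blinfun_inner_right z"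
    have "(LINT z|lborel. blinfun_apply (?\<psi>' z) a) = 0"
    proof (rule integral_directional_derivative_eq_0)
      show "((\<lambda>z. \<phi> z * \<kappa> n z) has_derivative blinfun_apply (?\<psi>' z)) (at z)" for z
        by (rule derivative_eq_intros der \<kappa>_der refl)+
           (simp add: fun_eq_iff blinfun.diff_left blinfun.scaleR_left algebra_simps)
      show "continuous_on UNIV ?\<psi>'"
        by (intro continuous_intros cont \<kappa>_cont \<phi>_cont bounded_linear.continuous_on[OF bounded_linear_blinfun_inner_right])
    qed (use supp in auto)
    then show ?thesis
      using int3 int4 by (simp add: blinfun.diff_left blinfun.scaleR_left inner_commute mult_ac)
  qed
  have [measurable]: "\<kappa> n \<in> borel_measurable borel" "\<phi> \<in> borel_measurable borel" "(\<lambda>z. blinfun_apply (\<phi>' z) a) \<in> borel_measurable borel" for n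
    by (intro borel_measurable_continuous_onI \<kappa>_cont \<phi>_cont continuous_intros cont)+
  have lim1: "(\<lambda>n. LINT z|lborel. blinfun_apply (\<phi>' z) a * \<kappa> n z) \<longlonglongrightarrow> (LINT z|lborel. blinfun_apply (\<phi>' z) a / norm z)"
  proof (rule integral_dominated_convergence)
    show "integrable lborel (\<lambda>z. \<bar>blinfun_apply (\<phi>' z) a / norm z\<bar>)"
      using integrable_abs[OF int1[OF locally_integrable_norm_power[of 1]]] dim by simp
    show "AE z in lborel. (\<lambda>n. blinfun_apply (\<phi>' z) a * \<kappa> n z) \<longlonglongrightarrow> blinfun_apply (\<phi>' z) a / norm z"
      using AE_lborel_singleton[of "0::'a"]
    proof eventually_elim
      case (elim z)
      then show ?case using tendsto_mult_left[OF \<kappa>_lim[OF elim], of "blinfun_apply (\<phi>' z) a"] by simp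
    qed
    show "AE z in lborel. norm (blinfun_apply (\<phi>' z) a * \<kappa> n z) \<le> \<bar>blinfun_apply (\<phi>' z) a / norm z\<bar>" for n
      using AE_lborel_singleton[of "0::'a"]
    proof eventually_elim
      case (elim z)
      then show ?case
        using mult_left_mono[OF \<kappa>_le[of z n], of "\<bar>blinfun_apply (\<phi>' z) a\<bar>"] \<kappa>_pos[of n z] by (simp add: abs_mult)
    qed
  qed measurable
  have lim2: "(\<lambda>n. LINT z|lborel. \<phi> z * (\<kappa> n z ^ 3 * (a \<bullet> z))) \<longlonglongrightarrow> (LINT z|lborel. \<phi> z * ((a \<bullet> z) / norm z ^ 3))"
  proof (rule integral_dominated_convergence)
    \<comment> \<open>By Cauchy-Schwarz and \<open>\<kappa> n z \<le> 1 / norm z\<close> the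
      singularity is at most of order 2, which is locally integrable because the dimension is at
      least 3.\<close>
    show "integrable lborel (\<lambda>z. norm a * \<bar>\<phi> z / norm z ^ 2\<bar>)"
      using integrable_mult_right[OF integrable_abs[OF int2[OF locally_integrable_norm_power[of 2]]]] dim by simp
    show "AE z in lborel. (\<lambda>n. \<phi> z * (\<kappa> n z ^ 3 * (a \<bullet> z))) \<longlonglongrightarrow> \<phi> z * ((a \<bullet> z) / norm z ^ 3)"
      using AE_lborel_singleton[of "0::'a"]
    proof eventually_elim
      case (elim z)
      have "(\<lambda>n. \<phi> z * (\<kappa> n z ^ 3 * (a \<bullet> z))) \<longlonglongrightarrow> \<phi> z * ((1 / norm z) ^ 3 * (a \<bullet> z))"
        using elim by (intro tendsto_intros \<kappa>_lim)
      then show ?case by (simp add: power_one_over)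
    qed
    show "AE z in lborel. norm (\<phi> z * (\<kappa> n z ^ 3 * (a \<bullet> z))) \<le> norm a * \<bar>\<phi> z / norm z ^ 2\<bar>" for n
      using AE_lborel_singleton[of "0::'a"]
    proof eventually_elim
      case (elim z)
      have "\<kappa> n z ^ 3 * \<bar>a \<bullet> z\<bar> \<le> (1 / norm z) ^ 3 * (norm a * norm z)"
        using \<kappa>_le[OF elim, of n] \<kappa>_pos[of n z] Cauchy_Schwarz_ineq2[of a z] by (intro mult_mono power_mono) auto
      also have "\<dots> = norm a / norm z ^ 2"
        using elim by (simp add: field_simps power3_eq_cube power2_eq_square)
      finally have "\<bar>\<phi> z\<bar> * (\<kappa> n z ^ 3 * \<bar>a \<bullet> z\<bar>) \<le> \<bar>\<phi> z\<bar> * (norm a / norm z ^ 2)"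
        by (intro mult_left_mono) auto
      then show ?case
        using \<kappa>_pos[of n z] by (simp add: abs_mult mult_ac)
    qed
  qed measurable
  show ?thesis
    using LIMSEQ_unique[OF lim1[unfolded eq] lim2] .
qed

section \<open>Marginals and kernels on a product space\<close>

lemma
  fixes h :: "'a::euclidean_space \<times> 'b::euclidean_space \<Rightarrow> 'c::{banach, second_countable_topology}"
  assumes "integrable lborel h"
  shows lborel_integral_fst: "(LINT x|lborel. LINT y|lborel. h (x, y)) = integral\<^sup>L lborel h"
    and lborel_integral_snd: "(LINT y|lborel. LINT x|lborel. h (x, y)) = integral\<^sup>L lborel h"
  using lborel_pair.integral_fst[of "curry h"] lborel_pair.integral_snd[of "curry h"] assms
  by (simp_all add: lborel_prod)

text \<open>The kernel is constant in the second variable, so Fubini pulls it out of the inner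
  integral and leaves the marginal of \<open>h\<close>. With the phase-space density as
  \<open>h\<close>, this marginal is the mass density.\<close>

lemma
  fixes h :: "'a::euclidean_space \<times> 'b::euclidean_space \<Rightarrow> real"
    and k :: "'a \<Rightarrow> 'c::{banach, second_countable_topology}"
  assumes cont: "continuous_on UNIV h" and supp: "\<And>p. norm p > R \<Longrightarrow> h p = 0" and k: "locally_integrable k"
  shows integrable_scaleR_fst: "integrable lborel (\<lambda>p. h p *\<^sub>R k (fst p))"
    and integral_scaleR_fst: "(LINT p|lborel. h p *\<^sub>R k (fst p)) = (LINT x|lborel. (LINT v|lborel. h (x, v)) *\<^sub>R k x)"
    and integrable_marginal: "integrable lborel (\<lambda>x. (LINT v|lborel. h (x, v)) *\<^sub>R k x)"
proof -
  show int: "integrable lborel (\<lambda>p. h p *\<^sub>R k (fst p))"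
    using cont supp locally_integrable_fst[OF k] by (rule integrable_scaleR_locally_integrable)
  have "integrable lborel (\<lambda>v. h (x, v) *\<^sub>R (1::real))" for x
  proof (rule integrable_scaleR_locally_integrable[OF _ _ locally_integrable_const])
    show "continuous_on UNIV (\<lambda>v. h (x, v))"
      by (intro continuous_on_compose2[OF cont] continuous_intros) auto
    show "h (x, v) = 0" if "norm v > R" for v
      using that norm_snd_le[of v x] by (intro supp) linarith
  qed
  then have inner: "(LINT v|lborel. h (x, v) *\<^sub>R k x) = (LINT v|lborel. h (x, v)) *\<^sub>R k x" for x
    by (intro integral_scaleR_left) simp
  from int have int': "integrable (lborel \<Otimes>\<^sub>M lborel) (\<lambda>p. h p *\<^sub>R k (fst p))"
    by (simp add: lborel_prod)
  from lborel_pair.integral_fst'[OF this]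
  show "(LINT p|lborel. h p *\<^sub>R k (fst p)) = (LINT x|lborel. (LINT v|lborel. h (x, v)) *\<^sub>R k x)"
    by (simp add: lborel_prod inner)
  from lborel_pair.integrable_fst'[OF int']
  show "integrable lborel (\<lambda>x. (LINT v|lborel. h (x, v)) *\<^sub>R k x)"
    by (simp add: inner)
qed

text \<open>Cauchy-Schwarz absorbs one power of the singularity into the numerator. What remains is
  \<open>1 / norm (fst p) ^ 2\<close> against \<open>h p * norm (w p)\<close>, which is continuous
  and inherits the compact support of \<open>h\<close>.\<close>

lemma integrable_inner_kernel:
  fixes h :: "'a::euclidean_space \<times> 'b::euclidean_space \<Rightarrow> real" and w :: "'a \<times> 'b \<Rightarrow> 'a"
  assumes dim: "DIM('a) \<ge> 3" and cont: "continuous_on UNIV h" "continuous_on UNIV w"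
    and supp: "\<And>p. norm p > R \<Longrightarrow> h p = 0"
  shows "integrable lborel (\<lambda>p. h p * ((w p \<bullet> fst p) / norm (fst p) ^ 3))"
proof (rule Bochner_Integration.integrable_bound)
  show "integrable lborel (\<lambda>p. (h p * norm (w p)) *\<^sub>R (1 / norm (fst p) ^ 2))"
    using supp dim
    by (intro integrable_scaleR_fst[where R = R] locally_integrable_norm_power continuous_intros cont) auto
  have [measurable]: "h \<in> borel_measurable borel" "w \<in> borel_measurable borel" "fst \<in> borel_measurable (borel :: ('a \<times> 'b) measure)"
    by (intro borel_measurable_continuous_onI cont continuous_intros)+
  show "(\<lambda>p. h p * ((w p \<bullet> fst p) / norm (fst p) ^ 3)) \<in> borel_measurable lborel"
    by measurable
  have "\<bar>w p \<bullet> fst p\<bar> / norm (fst p) ^ 3 \<le> norm (w p) / norm (fst p) ^ 2" for p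
  proof -
    have "\<bar>w p \<bullet> fst p\<bar> / norm (fst p) ^ 3 \<le> norm (w p) * norm (fst p) / norm (fst p) ^ 3"
      using Cauchy_Schwarz_ineq2 by (intro divide_right_mono) auto
    then show ?thesis
      by (cases "fst p = 0") (auto simp: power2_eq_square power3_eq_cube)
  qed
  from mult_left_mono[OF this, of "\<bar>h p\<bar>" for p]
  show "AE p in lborel. norm (h p * ((w p \<bullet> fst p) / norm (fst p) ^ 3)) \<le> norm ((h p * norm (w p)) *\<^sub>R (1 / norm (fst p) ^ 2))"
    by (simp add: abs_mult)
qed

lemma locally_integrable_scaleR_inverse_norm_cube:
  assumes "DIM('a::euclidean_space) \<ge> 3"
  shows "locally_integrable (\<lambda>z::'a. z /\<^sub>R norm z ^ 3)"
proof (rule locally_integrable_bound[OF locally_integrable_norm_power[where p = 2]])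
  show "norm (z /\<^sub>R norm z ^ 3) \<le> norm (1 / norm z ^ 2)" for z :: 'a
    by (cases "z = 0") (auto simp: power2_eq_square power3_eq_cube field_simps)
qed (use assms in auto)

text \<open>\<open>gradient\<close> is a definite description, so both existence and uniqueness are
  at stake: the Riesz vector of \<open>A\<close> is \<open>adjoint A 1\<close>, and it is the only
  one because derivatives are unique.\<close>

lemma inner_gradient:
  fixes \<phi> :: "'a::euclidean_space \<Rightarrow> real"
  assumes "(\<phi> has_derivative A) (at x)"
  shows "v \<bullet> gradient \<phi> x = A v"
proof -
  let ?D = "adjoint A 1"
  have "linear A" using assms by (rule has_derivative_linear)
  then have A: "A = (\<lambda>h. h \<bullet> ?D)"
    using adjoint_works[of A _ 1] by (simp add: fun_eq_iff)
  have "gradient \<phi> x = ?D"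
    unfolding gradient_def
  proof (rule the_equality)
    show "GDERIV \<phi> x :> ?D" using assms A by (simp add: gderiv_def)
    fix D assume "GDERIV \<phi> x :> D"
    then have "(\<lambda>h. h \<bullet> D) = A"
      using has_derivative_unique[OF _ assms] by (simp add: gderiv_def)
    then show "D = ?D"
      by (metis A euclidean_eqI inner_commute)
  qed
  then show ?thesis using A by metis
qed

section \<open>The Coulomb potential along a characteristic\<close>

text \<open>The three partial derivatives of the equation are packed into one total derivative: the
  density is stationary in the direction \<open>(1, v, E)\<close>. The derivative is taken within
  the half space of nonnegative times, hence one-sided in time at 0.\<close>

locale vlasov_poisson =
  fixes f :: "real \<Rightarrow> real^3 \<Rightarrow> real^3 \<Rightarrow> real"
    and f' :: "real \<times> (real^3) \<times> (real^3) \<Rightarrow> (real \<times> (real^3) \<times> (real^3)) \<Rightarrow>\<^sub>L real"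
  assumes der: "q \<in> {0..} \<times> UNIV \<Longrightarrow>
      ((\<lambda>(t, x, v). f t x v) has_derivative blinfun_apply (f' q)) (at q within {0..} \<times> UNIV)"
    and cont: "continuous_on ({0..} \<times> UNIV) f'"
    and supp: "T \<ge> 0 \<Longrightarrow> \<exists>R. \<forall>t\<in>{0..T}. \<forall>x v. f t x v \<noteq> 0 \<longrightarrow> norm x \<le> R \<and> norm v \<le> R"
    and vlasov: "t \<ge> 0 \<Longrightarrow> blinfun_apply (f' (t, x, v)) (1, v, coulomb_field f t x) = 0"
begin

section \<open>Support and phase-space derivatives at a fixed time\<close>

lemma support_cball:
  assumes "T \<ge> 0"
  obtains R where "\<And>t x v. t \<in> {0..T} \<Longrightarrow> norm (x, v) > R \<Longrightarrow> f t x v = 0"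
proof -
  obtain R where R: "\<And>t x v. t \<in> {0..T} \<Longrightarrow> f t x v \<noteq> 0 \<Longrightarrow> norm x \<le> R \<and> norm v \<le> R"
    using supp[OF assms] by blast
  \<comment> \<open>The norm of a pair is at most the sum of the norms of its components, whence
    twice the radius.\<close>
  show thesis
  proof (rule that[of "R + R"])
    fix t :: real and x v :: "real^3" assume "t \<in> {0..T}" "norm (x, v) > R + R"
    then show "f t x v = 0"
      using R[of t x v] norm_Pair_le[of x v] by (auto simp: not_le intro: ccontr)
  qed
qed

lemma support_cball_translate:
  assumes "t \<ge> 0"
  obtains R where "\<And>p. norm p > R \<Longrightarrow> f t (c + fst p) (snd p) = 0"
proof -
  obtain R where R: "\<And>s x v. s \<in> {0..t} \<Longrightarrow> norm (x, v) > R \<Longrightarrow> f s x v = 0"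
    using support_cball[OF assms] by blast
  show thesis
  proof (rule that[of "R + norm c"])
    fix p :: "(real^3) \<times> (real^3)" assume "norm p > R + norm c"
    moreover have "norm p \<le> norm ((c, 0) + p) + norm c"
      using norm_triangle_ineq4[of "(c, 0) + p" "(c, 0)"] by (simp add: norm_Pair)
    moreover have "(c, 0) + p = (c + fst p, snd p)" by (simp add: prod_eq_iff)
    ultimately show "f t (c + fst p) (snd p) = 0"
      using assms by (intro R) auto
  qed
qed

text \<open>The slice at a fixed time lies in the half space, even for \<open>t = 0\<close>, so the
  derivative within the half space restricts to an unrestricted one in position and
  velocity.\<close>

lemma has_derivative_phase_space:
  assumes "t \<ge> 0"
  shows "((\<lambda>p. f t (c + fst p) (snd p)) has_derivative (\<lambda>h. blinfun_apply (f' (t, c + fst p, snd p)) (0, h))) (at p)"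
proof -
  have "((\<lambda>p. (t, c + fst p, snd p)) has_derivative (\<lambda>h. (0, fst h, snd h))) (at p)"
    by (intro has_derivative_Pair has_derivative_const) (auto intro!: derivative_eq_intros)
  moreover have "((\<lambda>(t, x, v). f t x v) has_derivative blinfun_apply (f' (t, c + fst p, snd p)))
      (at (t, c + fst p, snd p) within range (\<lambda>p. (t, c + fst p, snd p)))"
    using assms by (intro has_derivative_subset[OF der]) auto
  ultimately show ?thesis
    by (auto dest!: has_derivative_in_compose)
qed

lemma continuous_phase_space:
  assumes "t \<ge> 0"
  shows "continuous_on UNIV (\<lambda>p. f t (c + fst p) (snd p))"
  by (intro continuous_at_imp_continuous_on ballI has_derivative_continuous[OF has_derivative_phase_space[OF assms]])

lemma continuous_derivative_phase_space:
  assumes "t \<ge> 0" "continuous_on S x" "continuous_on S v"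
  shows "continuous_on S (\<lambda>p. f' (t, x p, v p))"
  by (rule continuous_on_compose2[OF cont continuous_on_Pair[OF continuous_on_const continuous_on_Pair[OF assms(2,3)]]])
    (use assms(1) in auto)

lemma derivative_position:
  assumes "t \<ge> 0"
  shows "((\<lambda>z. f t (c + z) v) has_derivative blinfun_apply (f' (t, c + z, v) o\<^sub>L Blinfun (\<lambda>h. (0, h, 0)))) (at z)"
proof -
  have "((\<lambda>z. (z, v)) has_derivative (\<lambda>h. (h, 0))) (at z)"
    by (auto intro!: derivative_eq_intros)
  from has_derivative_compose[OF this has_derivative_phase_space[OF assms]]
  show ?thesis
    by (simp add: blinfun_compose.rep_eq comp_def bounded_linear_Blinfun_apply bounded_linear_Pair bounded_linear_ident bounded_linear_zero)
qed

lemma derivative_velocity: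
  assumes "t \<ge> 0"
  shows "((\<lambda>v. f t x v) has_derivative blinfun_apply (f' (t, x, v) o\<^sub>L Blinfun (\<lambda>h. (0, 0, h)))) (at v)"
proof -
  have "((\<lambda>v. (0, v)) has_derivative (\<lambda>h. (0, h))) (at v)"
    by (auto intro!: derivative_eq_intros)
  from has_derivative_compose[OF this has_derivative_phase_space[OF assms, of x]]
  show ?thesis
    by (simp add: blinfun_compose.rep_eq comp_def bounded_linear_Blinfun_apply bounded_linear_Pair bounded_linear_ident bounded_linear_zero)
qed

section \<open>Potential, field and source centred at a point\<close>

lemma
  fixes k :: "real^3 \<Rightarrow> 'c::{banach, second_countable_topology}"
  assumes t: "t \<ge> 0" and k: "locally_integrable k"
  shows integrable_kernel: "integrable lborel (\<lambda>p. f t (c + fst p) (snd p) *\<^sub>R k (fst p))"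
    and integral_mass_density: "(LINT y|lborel. mass_density f t y *\<^sub>R k (y - c)) = (LINT p|lborel. f t (c + fst p) (snd p) *\<^sub>R k (fst p))"
proof -
  note cont_f = continuous_phase_space[OF t]
  obtain R where R: "\<And>p. norm p > R \<Longrightarrow> f t (c + fst p) (snd p) = 0"
    using support_cball_translate[OF t] by blast
  show "integrable lborel (\<lambda>p. f t (c + fst p) (snd p) *\<^sub>R k (fst p))"
    using cont_f R k by (rule integrable_scaleR_fst)
  \<comment> \<open>Centre 0 and kernel 1 give integrability of the mass density, from which its
    measurability is taken for the change of variables.\<close>
  obtain R0 where R0: "\<And>p. norm p > R0 \<Longrightarrow> f t (0 + fst p) (snd p) = 0"
    using support_cball_translate[OF t] by blast
  have "integrable lborel (\<lambda>x. (LINT v|lborel. f t (0 + fst (x, v)) (snd (x, v))) *\<^sub>R (1::real))"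
    using cont_f R0 locally_integrable_const by (rule integrable_marginal)
  then have [measurable]: "(\<lambda>y. mass_density f t y) \<in> borel_measurable borel"
    by (simp add: mass_density_def borel_measurable_integrable)
  have [measurable]: "k \<in> borel_measurable borel"
    using k by (simp add: locally_integrable_def)
  \<comment> \<open>The substitution \<open>y = c + z\<close> fixes the kernel and shifts the
    density; Fubini then opens the density into an integral over velocities.\<close>
  have "(LINT y|lborel. mass_density f t y *\<^sub>R k (y - c)) = (LINT z|lborel. mass_density f t (c + z) *\<^sub>R k (c + z - c))"
    by (rule lborel_integral_translate[symmetric]) measurable
  also have "\<dots> = (LINT z|lborel. (LINT v|lborel. f t (c + fst (z, v)) (snd (z, v))) *\<^sub>R k z)"
    by (simp add: mass_density_def)
  also have "\<dots> = (LINT p|lborel. f t (c + fst p) (snd p) *\<^sub>R k (fst p))"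
    using cont_f R k by (rule integral_scaleR_fst[symmetric])
  finally show "(LINT y|lborel. mass_density f t y *\<^sub>R k (y - c)) = (LINT p|lborel. f t (c + fst p) (snd p) *\<^sub>R k (fst p))" .
qed

lemma potential_eq:
  assumes "t \<ge> 0"
  shows "potential f t c = 1 / (4 * pi) * (LINT p|lborel. f t (c + fst p) (snd p) / norm (fst p))"
proof -
  have "(LINT y|lborel. mass_density f t y *\<^sub>R (1 / norm (y - c) ^ 1)) = (LINT p|lborel. f t (c + fst p) (snd p) *\<^sub>R (1 / norm (fst p) ^ 1))"
    by (intro integral_mass_density[OF assms] locally_integrable_norm_power) simp
  then show ?thesis
    by (simp add: potential_def norm_minus_commute)
qed

text \<open>The centred variable \<open>y - c\<close> is opposite to the argument
  \<open>c - y\<close> of the odd field kernel, which accounts for the minus sign.\<close>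

lemma inner_coulomb_field_eq:
  assumes "t \<ge> 0"
  shows "a \<bullet> coulomb_field f t c = - (1 / (4 * pi) * (LINT p|lborel. f t (c + fst p) (snd p) * ((a \<bullet> fst p) / norm (fst p) ^ 3)))"
proof -
  have k: "locally_integrable (\<lambda>z::real^3. z /\<^sub>R norm z ^ 3)"
    by (rule locally_integrable_scaleR_inverse_norm_cube) simp
  have "(c - y) /\<^sub>R norm (c - y) ^ 3 = - ((y - c) /\<^sub>R norm (y - c) ^ 3)" for y
    by (metis minus_diff_eq norm_minus_commute scaleR_minus_right)
  then have "coulomb_field f t c = - ((1 / (4 * pi)) *\<^sub>R (LINT y|lborel. mass_density f t y *\<^sub>R ((y - c) /\<^sub>R norm (y - c) ^ 3)))"
    by (simp add: coulomb_field_def)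
  also have "\<dots> = - ((1 / (4 * pi)) *\<^sub>R (LINT p|lborel. f t (c + fst p) (snd p) *\<^sub>R (fst p /\<^sub>R norm (fst p) ^ 3)))"
    by (subst integral_mass_density[OF assms k]) (rule refl)
  finally have "a \<bullet> coulomb_field f t c = - (1 / (4 * pi) * (a \<bullet> (LINT p|lborel. f t (c + fst p) (snd p) *\<^sub>R (fst p /\<^sub>R norm (fst p) ^ 3))))"
    by simp
  also have "a \<bullet> (LINT p|lborel. f t (c + fst p) (snd p) *\<^sub>R (fst p /\<^sub>R norm (fst p) ^ 3))
      = (LINT p|lborel. a \<bullet> (f t (c + fst p) (snd p) *\<^sub>R (fst p /\<^sub>R norm (fst p) ^ 3)))"
    using integrable_kernel[OF assms k] by (intro integral_inner_right[symmetric])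
  also have "(\<lambda>p. a \<bullet> (f t (c + fst p) (snd p) *\<^sub>R (fst p /\<^sub>R norm (fst p) ^ 3)))
      = (\<lambda>p. f t (c + fst p) (snd p) * ((a \<bullet> fst p) / norm (fst p) ^ 3))"
    by (rule ext) (simp only: inner_scaleR_right divide_inverse mult_ac)
  finally show ?thesis .
qed

lemma integrable_velocity_kernel:
  assumes "t \<ge> 0" and "continuous_on UNIV w"
  shows "integrable lborel (\<lambda>p. f t (c + fst p) (snd p) * ((w p \<bullet> fst p) / norm (fst p) ^ 3))"
proof -
  obtain R where R: "\<And>p. norm p > R \<Longrightarrow> f t (c + fst p) (snd p) = 0"
    using support_cball_translate[OF assms(1)] by blast
  show ?thesis
    using continuous_phase_space[OF assms(1)] assms(2) R by (intro integrable_inner_kernel) (auto simp: DIM_cart)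
qed

lemma char_source_eq:
  assumes t: "t \<ge> 0"
  shows "char_source f X t = 1 / (1 + t) * potential f t (X t) - (X t /\<^sub>R (1 + t)) \<bullet> coulomb_field f t (X t)
      - 1 / (4 * pi) * (LINT p|lborel. f t (X t + fst p) (snd p) * ((snd p \<bullet> fst p) / norm (fst p) ^ 3))"
proof -
  let ?c = "X t" and ?s = "1 / (1 + t)"
  let ?f = "\<lambda>p. f t (?c + fst p) (snd p)"
  have f0: "(\<lambda>p. f t (fst p) (snd p)) \<in> borel_measurable borel"
    using continuous_phase_space[OF t, of 0] by (intro borel_measurable_continuous_onI) simp
  let ?g = "\<lambda>(x, v). (rel_velocity t x v \<bullet> ((?c - x) /\<^sub>R norm (?c - x) ^ 3)) * f t x v"
  have "?g \<in> borel_measurable borel"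
  proof -
    have [measurable]: "(\<lambda>p. f t (fst p) (snd p)) \<in> borel_measurable (borel \<Otimes>\<^sub>M borel)"
      using f0 by (simp add: borel_prod)
    show ?thesis
      unfolding borel_prod[symmetric] rel_velocity_def split_beta by measurable
  qed
  then have "integral\<^sup>L lborel ?g = (LINT p|lborel. ?g ((?c, 0) + p))"
    by (rule lborel_integral_translate[symmetric])
  also have "\<dots> = (LINT p|lborel. ?s * (?f p * ((?c \<bullet> fst p) / norm (fst p) ^ 3)) + ?s * (?f p / norm (fst p))
      - ?f p * ((snd p \<bullet> fst p) / norm (fst p) ^ 3))"
  proof (intro Bochner_Integration.integral_cong refl)
    fix p :: "(real^3) \<times> (real^3)"
    obtain z v where p: "p = (z, v)" by (cases p)
    \<comment> \<open>At \<open>z = 0\<close> both sides are 0, as division by zero gives 0.\<close>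
    have "(z \<bullet> z) / norm z ^ 3 = 1 / norm z"
      by (cases "z = 0") (simp_all add: dot_square_norm power2_eq_square power3_eq_cube)
    then have z: "?s * ((z \<bullet> z) / norm z ^ 3) = ?s * (1 / norm z)" by simp
    have "rel_velocity t (?c + z) v \<bullet> ((- z) /\<^sub>R norm z ^ 3)
        = ?s * ((?c \<bullet> z) / norm z ^ 3) + ?s * ((z \<bullet> z) / norm z ^ 3) - (v \<bullet> z) / norm z ^ 3"
      by (simp add: rel_velocity_def inner_diff_left inner_add_left divide_inverse algebra_simps)
    then show "?g ((?c, 0) + p) = ?s * (?f p * ((?c \<bullet> fst p) / norm (fst p) ^ 3)) + ?s * (?f p / norm (fst p))
        - ?f p * ((snd p \<bullet> fst p) / norm (fst p) ^ 3)"
      unfolding z by (simp add: p algebra_simps)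
  qed
  also have "\<dots> = ?s * (LINT p|lborel. ?f p * ((?c \<bullet> fst p) / norm (fst p) ^ 3)) + ?s * (LINT p|lborel. ?f p / norm (fst p))
      - (LINT p|lborel. ?f p * ((snd p \<bullet> fst p) / norm (fst p) ^ 3))"
  proof -
    have 1: "integrable lborel (\<lambda>p. ?f p * ((?c \<bullet> fst p) / norm (fst p) ^ 3))"
      "integrable lborel (\<lambda>p. ?f p * ((snd p \<bullet> fst p) / norm (fst p) ^ 3))"
      by (intro integrable_velocity_kernel t continuous_intros)+
    have "integrable lborel (\<lambda>p. ?f p *\<^sub>R (1 / norm (fst p) ^ 1))"
      by (intro integrable_kernel t locally_integrable_norm_power) simp
    then have 2: "integrable lborel (\<lambda>p. ?f p / norm (fst p))" by simp
    show ?thesis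
      using 1 2 by (simp del: times_divide_eq_left times_divide_eq_right)
  qed
  finally have eq: "integral\<^sup>L lborel ?g = ?s * (LINT p|lborel. ?f p * ((?c \<bullet> fst p) / norm (fst p) ^ 3))
      + ?s * (LINT p|lborel. ?f p / norm (fst p)) - (LINT p|lborel. ?f p * ((snd p \<bullet> fst p) / norm (fst p) ^ 3))" .
  \<comment> \<open>Here \<open>k\<close> is \<open>1 / (4 * pi)\<close>, \<open>s\<close> is
    \<open>1 / (1 + t)\<close>, and \<open>A\<close>, \<open>P\<close>, \<open>C\<close> are the
    integrals belonging to the field, the potential and the velocity moment.\<close>
  have alg: "k * (s * A + s * P - C) = s * (k * P) - s * (- (k * A)) - k * C" for k s A P C :: real
    by (simp add: algebra_simps)
  show ?thesis
    unfolding char_source_def eq potential_eq[OF t] inner_scaleR_left inner_coulomb_field_eq[OF t, of ?c]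
    by (simp only: alg inverse_eq_divide)
qed

section \<open>Time derivative of the potential\<close>

text \<open>The two parts given by the Vlasov equation are integrated in opposite orders. The field
  is constant in \<open>v\<close>, so its part vanishes on integrating over \<open>v\<close> first;
  the direction \<open>a - v\<close> is constant in \<open>z\<close>, so integration by parts
  applies on integrating over \<open>z\<close> first.\<close>

lemma integral_transport_eq:
  assumes t: "t \<ge> 0"
  shows "(LINT p|lborel. blinfun_apply (f' (t, c + fst p, snd p)) (1, a, 0) / norm (fst p))
      = (LINT p|lborel. f t (c + fst p) (snd p) * (((a - snd p) \<bullet> fst p) / norm (fst p) ^ 3))"
proof -
  let ?D = "\<lambda>p. blinfun_apply (f' (t, c + fst p, snd p))"
  let ?A = "\<lambda>p. ?D p (0, a - snd p, 0)"
  let ?B = "\<lambda>p. ?D p (0, 0, coulomb_field f t (c + fst p))"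
  obtain R where R: "\<And>p. norm p > R \<Longrightarrow> f t (c + fst p) (snd p) = 0"
    using support_cball_translate[OF t] by blast
  have vl: "?D p (1, a, 0) = ?A p - ?B p" for p
  proof -
    have "(1::real, a, 0) = (1, snd p, coulomb_field f t (c + fst p))
        + ((0, a - snd p, 0) - (0, 0, coulomb_field f t (c + fst p)))"
      by (simp add: prod_eq_iff)
    then show ?thesis
      by (simp only: blinfun.add_right blinfun.diff_right vlasov[OF t])
  qed
  have D0: "?D p (0, h) = 0" if "norm p > R" for p h
    using has_derivative_eq_0_outside_cball[OF has_derivative_phase_space[OF t] R that] by (rule fun_cong)
  \<comment> \<open>This direction has a time component, which the support argument at fixed
    \<open>t\<close> does not reach; \<open>vl\<close> reduces it to phase-space directions.\<close>
  have D1: "?D p (1, a, 0) = 0" if "norm p > R" for p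
    using D0[OF that] unfolding vl by simp
  have f'_cont: "continuous_on UNIV (\<lambda>p. f' (t, c + fst p, snd p))"
    by (intro continuous_derivative_phase_space t continuous_intros)
  have inv_norm: "locally_integrable (\<lambda>z::real^3. 1 / norm z ^ 1)"
    by (rule locally_integrable_norm_power) simp
  have int: "integrable lborel (\<lambda>p. ?D p (1, a, 0) / norm (fst p))"
  proof -
    have "integrable lborel (\<lambda>p. ?D p (1, a, 0) *\<^sub>R (1 / norm (fst p) ^ 1))"
      using D1 by (intro integrable_scaleR_fst[OF _ _ inv_norm] continuous_intros f'_cont)
    then show ?thesis by simp
  qed
  have intA: "integrable lborel (\<lambda>p. ?A p / norm (fst p))"
  proof -
    have "integrable lborel (\<lambda>p. ?A p *\<^sub>R (1 / norm (fst p) ^ 1))"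
      using D0 by (intro integrable_scaleR_fst[OF _ _ inv_norm] continuous_intros f'_cont)
    then show ?thesis by simp
  qed
  \<comment> \<open>No continuity of the field in position is at hand, so integrability is inherited
    from the other two terms of \<open>vl\<close>.\<close>
  have intB: "integrable lborel (\<lambda>p. ?B p / norm (fst p))"
    using Bochner_Integration.integrable_diff[OF intA int] unfolding vl by (simp add: diff_divide_distrib)
  have emb1: "bounded_linear (\<lambda>h::real^3. (0::real, h, 0::real^3))" and emb2: "bounded_linear (\<lambda>h::real^3. (0::real, 0::real^3, h))"
    by (intro bounded_linear_Pair bounded_linear_zero bounded_linear_ident)+
  have B0: "(LINT v|lborel. ?B (z, v) / norm (fst (z, v))) = 0" for z
  proof -
    have "(LINT v|lborel. blinfun_apply (f' (t, c + z, v) o\<^sub>L Blinfun (\<lambda>h. (0, 0, h))) (coulomb_field f t (c + z))) = 0"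
    proof (rule integral_directional_derivative_eq_0)
      show "((\<lambda>v. f t (c + z) v) has_derivative blinfun_apply (f' (t, c + z, v) o\<^sub>L Blinfun (\<lambda>h. (0, 0, h)))) (at v)" for v
        by (rule derivative_velocity[OF t])
      show "continuous_on UNIV (\<lambda>v. f' (t, c + z, v) o\<^sub>L Blinfun (\<lambda>h. (0, 0, h)))"
        by (intro continuous_intros continuous_derivative_phase_space t)
      show "f t (c + z) v = 0" if "norm v > R" for v
        using R[of "(z, v)"] that norm_snd_le[of v z] by simp
    qed
    then show ?thesis
      using emb2 by (simp add: blinfun_compose.rep_eq bounded_linear_Blinfun_apply)
  qed
  have intB0: "(LINT p|lborel. ?B p / norm (fst p)) = 0"
    by (simp only: lborel_integral_fst[OF intB, symmetric] B0 Bochner_Integration.integral_zero)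
  let ?K = "\<lambda>p. f t (c + fst p) (snd p) * (((a - snd p) \<bullet> fst p) / norm (fst p) ^ 3)"
  have intK: "integrable lborel ?K"
    by (intro integrable_velocity_kernel t continuous_intros)
  have AK: "(LINT z|lborel. ?A (z, v) / norm (fst (z, v))) = (LINT z|lborel. ?K (z, v))" for v
  proof -
    have "(LINT z|lborel. blinfun_apply (f' (t, c + z, v) o\<^sub>L Blinfun (\<lambda>h. (0, h, 0))) (a - v) / norm z)
        = (LINT z|lborel. f t (c + z) v * (((a - v) \<bullet> z) / norm z ^ 3))"
    proof (rule integral_by_parts_inverse_norm)
      show "((\<lambda>z. f t (c + z) v) has_derivative blinfun_apply (f' (t, c + z, v) o\<^sub>L Blinfun (\<lambda>h. (0, h, 0)))) (at z)" for z
        by (rule derivative_position[OF t])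
      show "continuous_on UNIV (\<lambda>z. f' (t, c + z, v) o\<^sub>L Blinfun (\<lambda>h. (0, h, 0)))"
        by (intro continuous_intros continuous_derivative_phase_space t)
      show "f t (c + z) v = 0" if "norm z > R" for z
        using R[of "(z, v)"] that norm_fst_le[of z v] by simp
    qed (simp add: DIM_cart)
    then show ?thesis
      using emb1 by (simp add: blinfun_compose.rep_eq bounded_linear_Blinfun_apply)
  qed
  have "(LINT p|lborel. ?D p (1, a, 0) / norm (fst p)) = (LINT p|lborel. ?A p / norm (fst p)) - (LINT p|lborel. ?B p / norm (fst p))"
    unfolding vl diff_divide_distrib using intA intB by (rule Bochner_Integration.integral_diff)
  also have "\<dots> = (LINT p|lborel. ?A p / norm (fst p))"
    by (simp only: intB0 diff_0_right)
  also have "\<dots> = (LINT v|lborel. LINT z|lborel. ?A (z, v) / norm (fst (z, v)))"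
    by (rule lborel_integral_snd[OF intA, symmetric])
  also have "\<dots> = (LINT v|lborel. LINT z|lborel. ?K (z, v))"
    by (simp only: AK)
  also have "\<dots> = integral\<^sup>L lborel ?K"
    by (rule lborel_integral_snd[OF intK])
  finally show ?thesis .
qed

text \<open>In phase space the centre is \<open>(X s, 0)\<close>, so the density is differentiated
  along \<open>(1, a, 0)\<close>. Splitting \<open>a - v\<close> afterwards separates the work of
  the field from the velocity moment.\<close>

lemma has_real_derivative_potential:
  assumes I: "I \<subseteq> {0..}" and tI: "t \<in> I" and X: "(X has_vector_derivative a) (at t within I)"
  shows "((\<lambda>s. potential f s (X s)) has_real_derivative
      - (a \<bullet> coulomb_field f t (X t))
      - 1 / (4 * pi) * (LINT p|lborel. f t (X t + fst p) (snd p) * ((snd p \<bullet> fst p) / norm (fst p) ^ 3))) (at t within I)"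
proof -
  have t: "t \<ge> 0" using I tI by auto
  \<comment> \<open>The support must be controlled beyond \<open>t\<close>, so that times slightly
    later than \<open>t\<close> are covered.\<close>
  then obtain R where R: "\<And>s x v. s \<in> {0..t + 1} \<Longrightarrow> norm (x, v) > R \<Longrightarrow> f s x v = 0"
    using support_cball[of "t + 1"] by fastforce
  let ?g = "\<lambda>(t, x, v). f t x v"
  let ?k = "\<lambda>p::(real^3) \<times> (real^3). 1 / norm (fst p) ^ 1"
  have "((\<lambda>s. LINT p|lborel. ?g (s, (X s, 0) + p) * ?k p) has_real_derivative
      (LINT p|lborel. blinfun_apply (f' (t, (X t, 0) + p)) (1, (a, 0)) * ?k p)) (at t within I)"
  proof (rule has_real_derivative_integral_translate[OF der cont _ I tI])
    show "((\<lambda>s. (X s, 0)) has_vector_derivative (a, 0)) (at t within I)"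
      using X by (intro has_vector_derivative_Pair has_vector_derivative_const)
    show "locally_integrable ?k"
      by (intro locally_integrable_fst locally_integrable_norm_power) simp
    show "?g (s, p) = 0" if "s \<in> {0..t + 1}" "norm p > R" for s p
      using that by (cases p) (auto intro: R)
  qed auto
  moreover have "(X s, 0::real^3) + p = (X s + fst p, snd p)" for s p
    by (simp add: prod_eq_iff)
  ultimately have "((\<lambda>s. LINT p|lborel. f s (X s + fst p) (snd p) / norm (fst p)) has_real_derivative
      (LINT p|lborel. f t (X t + fst p) (snd p) * (((a - snd p) \<bullet> fst p) / norm (fst p) ^ 3))) (at t within I)"
    by (simp add: integral_transport_eq[OF t])
  from DERIV_cmult[OF this, of "1 / (4 * pi)"]
  have "((\<lambda>s. potential f s (X s)) has_real_derivative
      1 / (4 * pi) * (LINT p|lborel. f t (X t + fst p) (snd p) * (((a - snd p) \<bullet> fst p) / norm (fst p) ^ 3))) (at t within I)"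
    by (rule has_field_derivative_transform_within[where d = 1]) (use I tI in \<open>auto simp: potential_eq\<close>)
  moreover have "(LINT p|lborel. f t (X t + fst p) (snd p) * (((a - snd p) \<bullet> fst p) / norm (fst p) ^ 3))
      = (LINT p|lborel. f t (X t + fst p) (snd p) * ((a \<bullet> fst p) / norm (fst p) ^ 3))
      - (LINT p|lborel. f t (X t + fst p) (snd p) * ((snd p \<bullet> fst p) / norm (fst p) ^ 3))"
    unfolding inner_diff_left diff_divide_distrib right_diff_distrib
    by (intro Bochner_Integration.integral_diff integrable_velocity_kernel t continuous_intros)
  ultimately show ?thesis
    by (simp add: inner_coulomb_field_eq[OF t] right_diff_distrib diff_divide_distrib)
qed

end

section \<open>From partial derivatives to the total derivative\<close>

text \<open>The solution predicate uses \<open>vector_derivative\<close> and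
  \<open>gradient\<close>. Total differentiability identifies them with values of \<open>f'\<close>
  on coordinate directions, and linearity joins these into the single direction
  \<open>(1, v, E)\<close>.\<close>

lemma vlasov_poisson_if_solution:
  assumes sol: "vlasov_poisson_solution f\<^sub>0 f"
  obtains f' where "vlasov_poisson f f'"
proof -
  obtain f' :: "real \<times> (real^3) \<times> (real^3) \<Rightarrow> (real \<times> (real^3) \<times> (real^3)) \<Rightarrow>\<^sub>L real"
    where "\<forall>q\<in>{0..} \<times> UNIV. ((\<lambda>(t, x, v). f t x v) has_derivative blinfun_apply (f' q)) (at q within {0..} \<times> UNIV)"
    and cont: "continuous_on ({0..} \<times> UNIV) f'"
    using sol unfolding vlasov_poisson_solution_def C1_on_def by auto
  then have der: "((\<lambda>(t, x, v). f t x v) has_derivative blinfun_apply (f' q)) (at q within {0..} \<times> UNIV)"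
    if "q \<in> {0..} \<times> UNIV" for q
    using that by blast
  \<comment> \<open>The chain rule along a map into the half space, used for the time, position and
    velocity slices.\<close>
  have slice: "((\<lambda>y. f (fst (\<gamma> y)) (fst (snd (\<gamma> y))) (snd (snd (\<gamma> y)))) has_derivative (\<lambda>h. blinfun_apply (f' (\<gamma> y)) (L h))) (at y within S)"
    if "(\<gamma> has_derivative L) (at y within S)" "\<gamma> ` S \<subseteq> {0..} \<times> UNIV" "y \<in> S" for \<gamma> L S and y :: "'b::real_normed_vector"
  proof -
    have "\<gamma> y \<in> {0..} \<times> UNIV" using that(2,3) by blast
    from has_derivative_in_compose[OF that(1) has_derivative_subset[OF der[OF this] that(2)]]
    show ?thesis by (simp add: case_prod_beta)
  qed
  have "vlasov_poisson f f'"
  proof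
    fix t :: real and x v :: "real^3" assume t: "t \<ge> 0"
    let ?D = "blinfun_apply (f' (t, x, v))" and ?E = "coulomb_field f t x"
    have dt: "vector_derivative (\<lambda>s. f s x v) (at t within {0..}) = ?D (1, 0, 0)"
    proof (rule vector_derivative_within)
      \<comment> \<open>A nontrivial filter makes the derivative in time unique; the right-hand
        neighbourhoods provide this at the boundary time 0 too.\<close>
      have "at_right t \<le> at t within {0..}" using t by (intro at_le) auto
      then show "at t within {0..} \<noteq> bot"
        by (metis bot.extremum_uniqueI trivial_limit_at_right_real)
      have "((\<lambda>s. (s, x, v)) has_derivative (\<lambda>h. (h, 0, 0))) (at t within {0..})"
        by (intro has_derivative_Pair has_derivative_ident has_derivative_const)
      from slice[OF this] t
      have "((\<lambda>s. f s x v) has_derivative (\<lambda>h. ?D (h, 0, 0))) (at t within {0..})"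
        by auto
      moreover have "(\<lambda>h. ?D (h, 0, 0)) = (\<lambda>h. h *\<^sub>R ?D (1, 0, 0))"
        by (rule ext) (subst blinfun.scaleR_right[symmetric], simp)
      ultimately show "((\<lambda>s. f s x v) has_vector_derivative ?D (1, 0, 0)) (at t within {0..})"
        by (simp only: has_vector_derivative_def)
    qed
    have dx: "((\<lambda>y. f t y v) has_derivative (\<lambda>h. ?D (0, h, 0))) (at x)"
    proof -
      have "((\<lambda>y. (t, y, v)) has_derivative (\<lambda>h. (0, h, 0))) (at x)"
        by (intro has_derivative_Pair has_derivative_ident has_derivative_const)
      from slice[OF this] t show ?thesis by auto
    qed
    have dv: "((\<lambda>u. f t x u) has_derivative (\<lambda>h. ?D (0, 0, h))) (at v)"
    proof -
      have "((\<lambda>u. (t, x, u)) has_derivative (\<lambda>h. (0, 0, h))) (at v)"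
        by (intro has_derivative_Pair has_derivative_ident has_derivative_const)
      from slice[OF this] t show ?thesis by auto
    qed
    have "?D (1, v, ?E) = ?D (1, 0, 0) + ?D (0, v, 0) + ?D (0, 0, ?E)"
      by (simp flip: blinfun.add_right)
    also have "\<dots> = 0"
      using sol t unfolding vlasov_poisson_solution_def dt[symmetric] inner_gradient[OF dx, symmetric] inner_gradient[OF dv, symmetric]
      by blast
    finally show "?D (1, v, ?E) = 0" .
  next
    fix T :: real assume "T \<ge> 0"
    then show "\<exists>R. \<forall>t\<in>{0..T}. \<forall>x v. f t x v \<noteq> 0 \<longrightarrow> norm x \<le> R \<and> norm v \<le> R"
      using sol unfolding vlasov_poisson_solution_def by blast
  qed (use der cont in auto)
  then show thesis by (rule that)
qed

section \<open>Kinetic energy and the energy balance\<close>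

text \<open>The derivative of \<open>X / (1 + t)\<close> is
  \<open>V / (1 + t) - X / (1 + t)^2\<close>, that is \<open>w / (1 + t)\<close>. Hence the
  derivative of \<open>w\<close> is \<open>E - w / (1 + t)\<close>, and pairing with
  \<open>w\<close> gives the damping term.\<close>

lemma has_real_derivative_rel_velocity:
  fixes X V :: "real \<Rightarrow> real^3"
  assumes X: "(X has_vector_derivative V t) (at t within I)" and V: "(V has_vector_derivative E) (at t within I)"
    and t: "t \<ge> 0"
  defines "w \<equiv> rel_velocity t (X t) (V t)"
  shows "((\<lambda>s. 1 / 2 * (norm (rel_velocity s (X s) (V s)))\<^sup>2) has_real_derivative
      w \<bullet> E - (norm w)\<^sup>2 / (1 + t)) (at t within I)"
proof -
  have "((\<lambda>s. inverse (1 + s)) has_real_derivative - (inverse (1 + t) ^ 2)) (at t within I)"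
    using t by (auto intro!: derivative_eq_intros simp: power2_eq_square)
  from has_vector_derivative_diff[OF V has_vector_derivative_scaleR[OF this X]]
  have "((\<lambda>s. rel_velocity s (X s) (V s)) has_vector_derivative E - w /\<^sub>R (1 + t)) (at t within I)"
    by (simp add: rel_velocity_def w_def power2_eq_square scaleR_diff_right)
  then have w': "((\<lambda>s. rel_velocity s (X s) (V s)) has_derivative (\<lambda>h. h *\<^sub>R (E - w /\<^sub>R (1 + t)))) (at t within I)"
    by (simp add: has_vector_derivative_def)
  have "((\<lambda>s. 1 / 2 * (rel_velocity s (X s) (V s) \<bullet> rel_velocity s (X s) (V s))) has_real_derivative
      w \<bullet> (E - w /\<^sub>R (1 + t))) (at t within I)"
    unfolding has_field_derivative_def
    using has_derivative_mult_right[OF has_derivative_inner[OF w' w'], of "1 / 2"]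
    by (simp add: w_def inner_commute mult_commute_abs)
  moreover have "w \<bullet> (E - w /\<^sub>R (1 + t)) = w \<bullet> E - (w \<bullet> w) / (1 + t)"
    by (simp add: inner_diff_right divide_inverse mult.commute)
  ultimately show ?thesis
    by (simp only: power2_norm_eq_inner)
qed

theorem proposition2p1:
  fixes f\<^sub>0 :: "(real^3) \<times> (real^3) \<Rightarrow> real"
    and f :: "real \<Rightarrow> real^3 \<Rightarrow> real^3 \<Rightarrow> real"
    and X V :: "real \<Rightarrow> real^3"
    and I :: "real set" and t :: real
  assumes "C1_on f\<^sub>0 UNIV" and "compactly_supported f\<^sub>0" and "\<And>z. f\<^sub>0 z \<ge> 0"
    and "vlasov_poisson_solution f\<^sub>0 f"
    and "characteristic f I X V"
    and "t \<in> I"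
  shows "\<exists>D. (char_energy f X V has_real_derivative D) (at t within I) \<and>
             D + ((norm (rel_velocity t (X t) (V t)))\<^sup>2 + potential f t (X t)) / (1 + t)
               = char_source f X t \<and>
             D + char_energy f X V t / (1 + t) \<le> \<bar>char_source f X t\<bar>"
proof -
  obtain f' where "vlasov_poisson f f'"
    using vlasov_poisson_if_solution[OF assms(4)] .
  then interpret vlasov_poisson f f' .
  have I: "I \<subseteq> {0..}" and X: "(X has_vector_derivative V t) (at t within I)"
    and V: "(V has_vector_derivative coulomb_field f t (X t)) (at t within I)"
    using assms(5,6) by (auto simp: characteristic_def)
  have t: "t \<ge> 0" using I assms(6) by auto
  define w where "w = rel_velocity t (X t) (V t)"
  define E where "E = coulomb_field f t (X t)"
  define A where "A = 1 / (4 * pi) * (LINT p|lborel. f t (X t + fst p) (snd p) * ((snd p \<bullet> fst p) / norm (fst p) ^ 3))"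
  let ?U = "potential f t (X t)"
  let ?D = "w \<bullet> E - (norm w)\<^sup>2 / (1 + t) + (- (V t \<bullet> E) - A)"
  have 1: "(char_energy f X V has_real_derivative ?D) (at t within I)"
    unfolding char_energy_def[abs_def] w_def E_def A_def
    by (intro DERIV_add has_real_derivative_rel_velocity has_real_derivative_potential X V t I assms(6))
  have src: "char_source f X t = 1 / (1 + t) * ?U - (X t /\<^sub>R (1 + t)) \<bullet> E - A"
    by (simp only: char_source_eq[OF t] E_def A_def)
  \<comment> \<open>The work \<open>V t \<bullet> E\<close> cancels between the kinetic and the
    potential part of \<open>?D\<close>; what is left of \<open>w \<bullet> E\<close> is the
    position term of the source.\<close>
  have "w \<bullet> E = V t \<bullet> E - (X t /\<^sub>R (1 + t)) \<bullet> E"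
    by (simp add: w_def rel_velocity_def inner_diff_left)
  then have 2: "?D + ((norm w)\<^sup>2 + ?U) / (1 + t) = char_source f X t"
    unfolding src by (simp add: add_divide_distrib)
  \<comment> \<open>The energy contains only half of \<open>(norm w)\<^sup>2\<close>, so the
    difference of the two sides is nonnegative.\<close>
  have "char_energy f X V t / (1 + t) \<le> ((norm w)\<^sup>2 + ?U) / (1 + t)"
    using t by (intro divide_right_mono) (auto simp: char_energy_def w_def)
  with 2 have "?D + char_energy f X V t / (1 + t) \<le> \<bar>char_source f X t\<bar>"
    by linarith
  with 1 2 show ?thesis
    unfolding w_def by blast
qed

end
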